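(* Let $\alpha<0$ and $\lambda>0$ be fixed, and let $f$, $s_0$ and $L_{12}(C)$ be as in the context. Then for $C>s_0$ $$L_{12}(C)>-\frac1\alpha,\qquad \lim_{C\to\infty}L_{12}(C)=-\frac1\alpha .$$ If $L_{12}(C)$ is monotone decreasing in $C$ (for $C>s_0$), then for given $L\in\left(-\frac1\alpha,L_{12}(s_0)\right)$ there exists one monotone increasing solution of $$u''+\lambda f(u)=0\ \text{ in }(0,L),\qquad u'(0)=\alpha u(0),\quad u'(L)=-\alpha u(L).$$
   Context: $f\in C^1(\mathbb{R})$ satisfies $f>0$, $f'\ge 0$ on $\mathbb{R}$, $\lim_{u\to\infty}f(u)/u=\infty$, and $f$ is integrable at $-\infty$. Set $F(u)=\int_{-\infty}^u f(t)\,dt$, $F^{-1}:(0,\infty)\to\mathbb{R}$, $s_0=F(0)$, $\gamma^*=\sqrt{\lambda}/\alpha<0$. For $C>0$ let $\mathcal{K}_C=\{(v,F^{-1}(C-v^2/2)): v^2<2C\}$ in the $(v,u)$-plane and $\mathcal{L}^\pm=\{(v,\pm\gamma^*v):v\in\mathbb{R}\}$. For $C\ge s_0$, $\mathcal{L}^+$ meets $\mathcal{K}_C$ in exactly two points $P_i^+=(v_i^+,u_i^+)$, $i=1,2$, with $v_1^+>v_2^+$, and $\mathcal{L}^-$ meets $\mathcal{K}_C$ in the reflected points $P_i^-=(v_i^-,u_i^-)=(-v_i^+,u_i^+)$. For $C>s_0$, $v_1^+>v_2^->0$, $u_1^+<0<u_2^-$; for $C=s_0$, $P_2^-=(0,0)$.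 For $C\ge s_0$ define $$L_{12}(C)=\int_{v_2^-}^{v_1^+}\frac{dv}{\sqrt{\lambda}\,f\left(F^{-1}\left(C-\frac{v^2}{2}\right)\right)},$$ the length of the interval of the monotone increasing solution which is represented, with $v=u'/\sqrt\lambda$, by the arc $\widehat{P_1^+P_2^-}$ of $\mathcal{K}_C$ from $P_1^+$ ($x=0$) to $P_2^-$ ($x=L$). *)

theory Defs
  imports "HOL-Analysis.Analysis"
begin

definition primF :: "(real \<Rightarrow> real) \<Rightarrow> real \<Rightarrow> real" where
  "primF f u = integral {..u} f"

text \<open>Under the hypotheses of the theorem \<open>primF f\<close> is a bijection from the reals onto the
  positive reals; \<open>invF f\<close> is only meaningful on positive arguments.\<close>

definition invF :: "(real \<Rightarrow> real) \<Rightarrow> real \<Rightarrow> real" where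
  "invF f = inv (primF f)"

definition s0 :: "(real \<Rightarrow> real) \<Rightarrow> real" where
  "s0 f = primF f 0"

definition gamma_star :: "real \<Rightarrow> real \<Rightarrow> real" where
  "gamma_star \<alpha> lam = sqrt lam / \<alpha>"

text \<open>Points of the phase plane are \<open>(v, u)\<close> with \<open>v = u' / sqrt lam\<close>.\<close>

definition curveK :: "(real \<Rightarrow> real) \<Rightarrow> real \<Rightarrow> (real \<times> real) set" where
  "curveK f C = {(v, invF f (C - v\<^sup>2 / 2)) | v. v\<^sup>2 < 2 * C}"

definition line_plus :: "real \<Rightarrow> real \<Rightarrow> (real \<times> real) set" where
  "line_plus \<alpha> lam = {(v, gamma_star \<alpha> lam * v) | v. True}"

text \<open>For \<open>C \<ge> s0 f\<close> the line meets the curve in exactly two points, so the maximum and minimum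
  below are taken over a two-element set.\<close>

definition v1_plus :: "real \<Rightarrow> real \<Rightarrow> (real \<Rightarrow> real) \<Rightarrow> real \<Rightarrow> real" where
  "v1_plus \<alpha> lam f C = Max (fst ` (line_plus \<alpha> lam \<inter> curveK f C))"

definition v2_plus :: "real \<Rightarrow> real \<Rightarrow> (real \<Rightarrow> real) \<Rightarrow> real \<Rightarrow> real" where
  "v2_plus \<alpha> lam f C = Min (fst ` (line_plus \<alpha> lam \<inter> curveK f C))"

text \<open>The curve is symmetric under \<open>v \<mapsto> -v\<close>, which also exchanges the lines
  \<open>u = gamma_star \<alpha> lam * v\<close> and \<open>u = - gamma_star \<alpha> lam * v\<close>; hence the intersection points with
  the latter line are the reflections of those with the former.\<close>

definition v2_minus :: "real \<Rightarrow> real \<Rightarrow> (real \<Rightarrow> real) \<Rightarrow> real \<Rightarrow> real" where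
  "v2_minus \<alpha> lam f C = - v2_plus \<alpha> lam f C"

definition L12 :: "real \<Rightarrow> real \<Rightarrow> (real \<Rightarrow> real) \<Rightarrow> real \<Rightarrow> real" where
  "L12 \<alpha> lam f C =
     integral {v2_minus \<alpha> lam f C .. v1_plus \<alpha> lam f C}
       (\<lambda>v. 1 / (sqrt lam * f (invF f (C - v\<^sup>2 / 2))))"

text \<open>Classical solutions on the interval from \<open>0\<close> to \<open>L\<close>: \<open>C\<^sup>1\<close> up to the end points (one-sided
  derivatives there, so that the boundary conditions make sense) and twice differentiable inside;
  continuity of the second derivative follows from the equation when \<open>f\<close> is continuous.
  Only the values of \<open>u\<close> on \<open>{0..L}\<close> matter.\<close>

definition robin_solution ::
    "real \<Rightarrow> real \<Rightarrow> (real \<Rightarrow> real) \<Rightarrow> real \<Rightarrow> (real \<Rightarrow> real) \<Rightarrow> bool" where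
  "robin_solution \<alpha> lam f L u \<longleftrightarrow>
     (\<exists>u' u''.
        (\<forall>x\<in>{0..L}. (u has_real_derivative u' x) (at x within {0..L})) \<and>
        continuous_on {0..L} u' \<and>
        (\<forall>x\<in>{0<..<L}. (u' has_real_derivative u'' x) (at x) \<and> u'' x + lam * f (u x) = 0) \<and>
        u' 0 = \<alpha> * u 0 \<and> u' L = - \<alpha> * u L)"

definition increasing_robin_solution ::
    "real \<Rightarrow> real \<Rightarrow> (real \<Rightarrow> real) \<Rightarrow> real \<Rightarrow> (real \<Rightarrow> real) \<Rightarrow> bool" where
  "increasing_robin_solution \<alpha> lam f L u \<longleftrightarrow>
     robin_solution \<alpha> lam f L u \<and> strict_mono_on {0..L} u"

end

theory Submission
  imports Defs
begin

text \<open>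
  Along a solution, with \<open>v = u' / sqrt lam\<close>, the energy \<open>C = F u + v\<^sup>2 / 2\<close> is constant, so
  an increasing solution runs along the curve \<open>u = orbit C v\<close> with \<open>v\<close> decreasing. The boundary
  conditions put its start on the line \<open>u = \<gamma> v\<close>, at \<open>v = b C\<close>, and its end on
  \<open>u = - \<gamma> v\<close>, at \<open>v = a C\<close>. Since \<open>v' = - sqrt lam * f (orbit C v)\<close>, the time spent per unit
  of \<open>v\<close> is \<open>time_density C v = 1 / (sqrt lam * f (orbit C v))\<close>, whose integral over
  \<open>{a C..b C}\<close> is \<open>L12\<close>.

  The function \<open>v * time_density C v\<close> is the derivative of \<open>- orbit C v / sqrt lam\<close>, and
  the boundary values of the orbit lie on the two lines; hence the first moment of the time density
  is exactly \<open>- (1 / \<alpha>) * (a C + b C)\<close> (\<open>time_density_first_moment\<close>). As \<open>v \<le> b C\<close>, the integral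
  itself is at least \<open>- (1 / \<alpha>) * (a C + b C) / b C\<close>, which exceeds \<open>- (1 / \<alpha>)\<close>
  for \<open>C > s0 f\<close>, where \<open>a C > 0\<close> (\<open>L12_greater\<close>). Conversely, \<open>f\<close> is nondecreasing and so is the time density; splitting at
  \<open>v = r * b C\<close> with \<open>r < 1\<close> bounds \<open>L12\<close> by
  \<open>b C * time_density C (r * b C) - (1 / \<alpha>) * (1 + a C / b C) / r\<close> (\<open>L12_upper_bound\<close>). Superlinearity
  of \<open>f\<close> makes both \<open>b C * time_density C (r * b C)\<close> and \<open>a C / b C\<close> vanish as \<open>C\<close> grows, and \<open>r\<close> can be
  taken arbitrarily close to \<open>1\<close>.

  \<open>L12\<close> is continuous on \<open>C \<ge> s0 f\<close>, so every length between its limit and its value at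
  \<open>s0 f\<close> is attained; inverting the antiderivative of the time density then yields a solution of that
  length (\<open>velocity_trajectory\<close>, \<open>exists_increasing_solution\<close>). Every increasing solution arises in
  this way (\<open>increasing_solution_is_orbit\<close>): its length determines \<open>C\<close> when \<open>L12\<close> is strictly
  decreasing, and \<open>C\<close> determines the solution.
\<close>

section \<open>Intervals and inverses of real functions\<close>

lemma between_affine:
  assumes "p < q" "t \<in> {0..1}"
  shows "p + t * (q - p) \<in> {p..(q::real)}"
proof -
  define s where "s = t * (q - p)"
  have "0 \<le> s" "s \<le> 1 * (q - p)"
    unfolding s_def using assms by (auto intro: mult_right_mono)
  then show ?thesis
    by (simp flip: s_def)
qed

lemma real_inverse_of_increasing:
  fixes A A' :: "real \<Rightarrow> real"
  assumes deriv: "\<And>v. v \<in> {p..q} \<Longrightarrow> (A has_real_derivative A' v) (at v)"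
    and pos: "\<And>v. v \<in> {p..q} \<Longrightarrow> 0 < A' v"
  obtains B where "\<And>v. v \<in> {p..q} \<Longrightarrow> B (A v) = v"
    and "\<And>v. v \<in> {p<..<q} \<Longrightarrow> (B has_real_derivative 1 / A' v) (at (A v))"
proof
  let ?B = "inv_into {p..q} A"
  have mono: "A v < A w" if "v \<in> {p..q}" "w \<in> {p..q}" "v < w" for v w
  proof (rule DERIV_pos_imp_increasing[OF that(3)])
    fix x assume "v \<le> x" "x \<le> w"
    then have "x \<in> {p..q}"
      using that by auto
    then show "\<exists>y. (A has_real_derivative y) (at x) \<and> 0 < y"
      using deriv pos by blast
  qed
  then have "inj_on A {p..q}"
    by (intro inj_onI) (metis linorder_neqE order_less_irrefl)
  then show BA: "?B (A v) = v" if "v \<in> {p..q}" for v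
    using that by simp
  show "(?B has_real_derivative 1 / A' v) (at (A v))" if v: "v \<in> {p<..<q}" for v
  proof -
    have pq: "p \<in> {p..q}" "q \<in> {p..q}" "v \<in> {p..q}"
      using v by auto
    have cont: "isCont A x" if "p \<le> x" "x \<le> q" for x
      using that by (intro DERIV_isCont[OF deriv]) simp
    have "isCont ?B (A v)"
    proof (rule isCont_inverse_function2[of p v q ?B A])
      show "p < v" "v < q"
        using v by auto
      show "?B (A z) = z" if "p \<le> z" "z \<le> q" for z
        using that by (intro BA) simp
    qed (rule cont)
    moreover have "A (?B y) = y" if y: "A p < y" "y < A q" for y
    proof -
      obtain x where "p \<le> x" "x \<le> q" "A x = y"
        using IVT[of A p y q] y v cont by auto
      then show ?thesis
        using BA[of x] by simp
    qed
    moreover have "A p < A v" "A v < A q"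
      using mono pq v by auto
    moreover have "(A has_real_derivative A' v) (at (?B (A v)))" "A' v \<noteq> 0"
      using deriv[OF pq(3)] pos[OF pq(3)] BA[OF pq(3)] by auto
    ultimately have "(?B has_real_derivative inverse (A' v)) (at (A v))"
      by (intro DERIV_inverse_function[of A "A' v" ?B "A v" "A p" "A q"])
    then show ?thesis
      by (simp add: inverse_eq_divide)
  qed
qed

section \<open>The nonlinearity and its primitive\<close>

locale superlinear_reaction =
  fixes f :: "real \<Rightarrow> real"
  assumes C1: "f C1_differentiable_on UNIV"
    and f_pos: "f u > 0"
    and deriv_f_nonneg: "deriv f u \<ge> 0"
    and superlinear: "filterlim (\<lambda>u. f u / u) at_top at_top"
    and integrable_left: "f integrable_on {..0}"
begin

abbreviation F where "F \<equiv> primF f"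
abbreviation G where "G \<equiv> invF f"

lemma f_has_derivative: "(f has_real_derivative deriv f u) (at u)"
  using C1 by (meson C1_differentiable_on_eq DERIV_deriv_iff_real_differentiable UNIV_I)

lemma f_mono: "x \<le> y \<Longrightarrow> f x \<le> f y"
  using deriv_nonneg_imp_mono[of x y f "deriv f"] f_has_derivative deriv_f_nonneg by auto

lemma isCont_f: "isCont f u"
  using f_has_derivative DERIV_isCont by blast

lemma continuous_on_f: "continuous_on S f"
  by (simp add: isCont_f continuous_at_imp_continuous_on)

lemma f_integrable_atMost: "f integrable_on {..a}"
proof -
  have abs: "f absolutely_integrable_on {..0}"
    using integrable_left f_pos by (intro nonnegative_absolutely_integrable_1) (auto simp: less_imp_le)
  have left: "f integrable_on {..min a 0}"
    using set_integrable_subset[OF abs, of "{..min a 0}"] set_lebesgue_integral_eq_integral(1) by force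
  have "f integrable_on {min a 0..a}"
    by (intro integrable_continuous_real continuous_on_f)
  moreover have "{..min a 0} \<inter> {min a 0..a} \<subseteq> {min a 0}"
    by auto
  ultimately have "f integrable_on ({..min a 0} \<union> {min a 0..a})"
    using left by (intro integrable_Un) (auto intro: negligible_subset)
  moreover have "{..min a 0} \<union> {min a 0..a} = {..a}"
    by auto
  ultimately show ?thesis
    by simp
qed

lemma F_diff:
  assumes "a \<le> b"
  shows "F b = F a + integral {a..b} f"
proof -
  have "(f has_integral (integral {..a} f + integral {a..b} f)) ({..a} \<union> {a..b})"
  proof (rule has_integral_Un)
    show "(f has_integral integral {..a} f) {..a}"
      using f_integrable_atMost by (simp add: integrable_integral)
    show "(f has_integral integral {a..b} f) {a..b}"
      by (intro integrable_integral integrable_continuous_real continuous_on_f)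
    have "{..a} \<inter> {a..b} \<subseteq> {a}" by auto
    then show "negligible ({..a} \<inter> {a..b})"
      using negligible_subset negligible_sing by blast
  qed
  moreover have "{..a} \<union> {a..b} = {..b}"
    using assms by auto
  ultimately show ?thesis
    by (simp add: primF_def integral_unique)
qed

lemma F_has_derivative: "(F has_real_derivative f u) (at u)"
proof -
  have "((\<lambda>x. F (u - 1) + integral {u - 1..x} f) has_real_derivative f u) (at u within {u - 1..u + 1})"
    by (auto intro!: derivative_eq_intros integral_has_real_derivative continuous_on_f)
  moreover have "at u within {u - 1..u + 1} = at u"
    by (rule at_within_interior) auto
  ultimately have "((\<lambda>x. F (u - 1) + integral {u - 1..x} f) has_real_derivative f u) (at u)"
    by simp
  then show ?thesis
    by (rule has_field_derivative_transform_within_open[where S = "{u - 1<..}"]) (auto simp: F_diff[symmetric])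
qed

lemma isCont_F: "isCont F u"
  using F_has_derivative DERIV_isCont by blast

lemma F_strict_mono: "x < y \<Longrightarrow> F x < F y"
  by (rule DERIV_pos_imp_increasing[of x y F]) (use F_has_derivative f_pos in auto)

lemma F_less_iff: "F x < F y \<longleftrightarrow> x < y"
  by (rule linorder_cases[of x y]) (auto dest: F_strict_mono)

lemma F_le_iff: "F x \<le> F y \<longleftrightarrow> x \<le> y"
  by (simp add: F_less_iff flip: not_less)

lemma F_inj: "inj F"
  by (auto intro!: injI simp: order.eq_iff F_le_iff)

lemma F_chord:
  assumes "a \<le> b"
  shows "(b - a) * f a \<le> F b - F a" "F b - F a \<le> (b - a) * f b"
proof -
  have "(b - a) * f a \<le> F b - F a \<and> F b - F a \<le> (b - a) * f b"
  proof (cases "a = b")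
    case False
    then obtain z where "a < z" "z < b" "F b - F a = (b - a) * f z"
      using MVT2[of a b F f] F_has_derivative assms by auto
    then show ?thesis
      using f_mono[of a z] f_mono[of z b] assms by (simp add: mult_left_mono)
  qed auto
  then show "(b - a) * f a \<le> F b - F a" "F b - F a \<le> (b - a) * f b"
    by auto
qed

lemma F_pos: "F u > 0"
proof -
  have "F (u - 1) \<ge> 0"
    unfolding primF_def using f_pos f_integrable_atMost by (intro integral_nonneg) (auto simp: less_imp_le)
  then show ?thesis
    using F_strict_mono[of "u - 1" u] by simp
qed

text \<open>Convergence of the improper integral at \<open>-\<infinity>\<close>: this makes \<^term>\<open>primF f\<close> map onto all of
  the positive reals.\<close>

lemma F_arbitrarily_small:
  assumes "e > 0"
  shows "\<exists>u. F u < e"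
proof -
  have "(f has_integral F 0) {..0}"
    using integrable_left by (simp add: primF_def integrable_integral)
  \<comment> \<open>integrals over large bounded intervals approximate the integral over \<^term>\<open>{..0::real}\<close>\<close>
  then obtain B where "B > 0" and
    B: "\<And>a b. ball 0 B \<subseteq> cbox a b \<Longrightarrow>
          norm (integral (cbox a b) (\<lambda>x. if x \<in> {..0} then f x else 0) - F 0) < e"
    using assms unfolding has_integral_alt' by meson
  have "integral {-B..B} (\<lambda>x. if x \<in> {..0} then f x else 0) = integral ({..0} \<inter> {-B..B}) f"
    by (rule integral_restrict_Int)
  also have "{..0} \<inter> {-B..B} = {-B..0}"
    using \<open>B > 0\<close> by auto
  finally have "\<bar>integral {-B..0} f - F 0\<bar> < e"
    using B[of "-B" B] by (simp add: subset_iff abs_less_iff)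
  then have "F (-B) < e"
    using F_diff[of "-B" 0] \<open>B > 0\<close> by simp
  then show ?thesis ..
qed

lemma F_surj:
  assumes "y > 0"
  shows "\<exists>u. F u = y"
proof -
  obtain p where p: "F p < y"
    using F_arbitrarily_small assms by blast
  \<comment> \<open>right of \<open>p\<close> the slope of \<open>F\<close> is at least \<open>f p\<close>, so \<open>F\<close> has reached \<open>y\<close> by \<open>q\<close>\<close>
  define q where "q = max p ((y - F p) / f p + p)"
  have "y - F p \<le> (q - p) * f p"
    using f_pos[of p] by (simp add: q_def max_def field_simps split: if_splits)
  moreover have "p \<le> q"
    by (simp add: q_def)
  ultimately have "y \<le> F q"
    using F_chord(1)[of p q] by simp
  then show ?thesis
    using IVT[of F p y q] p isCont_F \<open>p \<le> q\<close> by auto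
qed

lemma G_F [simp]: "G (F u) = u"
  by (simp add: invF_def F_inj)

lemma F_G: "y > 0 \<Longrightarrow> F (G y) = y"
  using F_surj G_F by metis

lemma isCont_G: "y > 0 \<Longrightarrow> isCont G y"
  using isCont_inverse_function2[of "G y - 1" "G y" "G y + 1" G F] isCont_F by (simp add: F_G)

lemma G_has_derivative:
  assumes "y > 0"
  shows "(G has_real_derivative 1 / f (G y)) (at y)"
  using DERIV_inverse_function[of F "f (G y)" G y 0 "y + 1"] assms F_has_derivative f_pos[of "G y"] F_G
    isCont_G by (simp add: inverse_eq_divide)

lemma G_less_iff: "x > 0 \<Longrightarrow> y > 0 \<Longrightarrow> G x < G y \<longleftrightarrow> x < y"
  by (metis F_G F_less_iff)

lemma filterlim_G: "filterlim G at_top at_top"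
  unfolding filterlim_at_top
proof
  fix Z
  show "\<forall>\<^sub>F y in at_top. Z \<le> G y"
    using eventually_ge_at_top[of "F Z"]
  proof eventually_elim
    case (elim y)
    then have "y > 0" using F_pos[of Z] by linarith
    with elim show ?case using F_G F_le_iff by metis
  qed
qed

lemma identity_over_f_tendsto_0: "((\<lambda>u. u / f u) \<longlongrightarrow> 0) at_top"
  using tendsto_inverse_0_at_top[OF superlinear] by simp

text \<open>Since \<open>f\<close> is nondecreasing, \<open>F u \<le> F 0 + u * f u\<close> for \<open>u \<ge> 0\<close>; so
  \<open>F u / (f u)\<^sup>2\<close> is at most \<open>F 0 / (f u)\<^sup>2 + u / f u\<close>, and superlinearity
  makes both terms small.\<close>

lemma sqrt_F_over_f_tendsto_0: "((\<lambda>u. sqrt (F u) / f u) \<longlongrightarrow> 0) at_top"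
proof -
  have f_top: "filterlim f at_top at_top"
  proof (rule filterlim_at_top_mono[OF filterlim_ident])
    have "\<forall>\<^sub>F u in at_top. 1 \<le> f u / u"
      using superlinear unfolding filterlim_at_top by blast
    then show "\<forall>\<^sub>F u in at_top. u \<le> f u"
      using eventually_gt_at_top[of 0] by eventually_elim simp
  qed
  then have "((\<lambda>u. inverse (f u)) \<longlongrightarrow> 0) at_top"
    by (rule tendsto_inverse_0_at_top)
  with identity_over_f_tendsto_0 have "((\<lambda>u. F 0 * (inverse (f u))\<^sup>2 + u / f u)
      \<longlongrightarrow> F 0 * 0\<^sup>2 + 0) at_top"
    by (intro tendsto_intros)
  then have upper: "((\<lambda>u. F 0 * (inverse (f u))\<^sup>2 + u / f u) \<longlongrightarrow> 0) at_top"
    by simp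
  have "((\<lambda>u. F u / (f u)\<^sup>2) \<longlongrightarrow> 0) at_top"
  proof (rule tendsto_sandwich[OF _ _ tendsto_const upper])
    show "\<forall>\<^sub>F u in at_top. 0 \<le> F u / (f u)\<^sup>2"
      using F_pos by (simp add: less_imp_le)
    show "\<forall>\<^sub>F u in at_top. F u / (f u)\<^sup>2 \<le> F 0 * (inverse (f u))\<^sup>2 + u / f u"
      using eventually_ge_at_top[of 0]
    proof eventually_elim
      case (elim u)
      have "F u \<le> F 0 + u * f u"
        using F_chord(2)[of 0 u] elim by simp
      then have "F u / (f u)\<^sup>2 \<le> (F 0 + u * f u) / (f u)\<^sup>2"
        by (intro divide_right_mono) auto
      also have "\<dots> = F 0 * (inverse (f u))\<^sup>2 + u / f u"
        using f_pos[of u] by (simp add: field_simps power2_eq_square)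
      finally show ?case .
    qed
  qed
  then have "((\<lambda>u. sqrt (F u / (f u)\<^sup>2)) \<longlongrightarrow> sqrt 0) at_top"
    by (rule tendsto_real_sqrt)
  then show ?thesis
    using f_pos by (simp add: real_sqrt_divide less_imp_le)
qed

end

section \<open>The phase plane\<close>

locale robin_phase_plane = superlinear_reaction f for f +
  fixes \<alpha> lam :: real
  assumes alpha_neg: "\<alpha> < 0" and lam_pos: "lam > 0"
begin

abbreviation \<gamma> where "\<gamma> \<equiv> gamma_star \<alpha> lam"
abbreviation a where "a \<equiv> v2_minus \<alpha> lam f"
abbreviation b where "b \<equiv> v1_plus \<alpha> lam f"

text \<open>The curve \<^term>\<open>curveK f C\<close> as a graph over the \<open>v\<close>-axis.\<close>

definition orbit :: "real \<Rightarrow> real \<Rightarrow> real" where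
  "orbit C v = G (C - v\<^sup>2 / 2)"

text \<open>The energy \<open>F u + v\<^sup>2 / 2\<close> at the point of \<^term>\<open>line_plus \<alpha> lam\<close> with abscissa \<open>v\<close>, so that
  its level sets are the intersections of the line with the curves.\<close>

definition line_energy :: "real \<Rightarrow> real" where
  "line_energy v = F (\<gamma> * v) + v\<^sup>2 / 2"

lemma gamma_neg: "\<gamma> < 0"
  using alpha_neg lam_pos by (simp add: gamma_star_def divide_less_0_iff)

lemma line_energy_0: "line_energy 0 = s0 f"
  by (simp add: line_energy_def s0_def)

lemma line_energy_has_derivative:
  "(line_energy has_real_derivative (\<gamma> * f (\<gamma> * v) + v)) (at v)"
  unfolding line_energy_def[abs_def]
  by (auto intro!: derivative_eq_intros DERIV_chain2[OF F_has_derivative])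

lemma isCont_line_energy: "isCont line_energy v"
  using line_energy_has_derivative DERIV_isCont by blast

lemma line_energy_slope_strict_mono:
  assumes "x < y"
  shows "\<gamma> * f (\<gamma> * x) + x < \<gamma> * f (\<gamma> * y) + y"
proof -
  have "f (\<gamma> * y) \<le> f (\<gamma> * x)"
    using assms gamma_neg by (intro f_mono) simp
  then have "\<gamma> * f (\<gamma> * x) \<le> \<gamma> * f (\<gamma> * y)"
    using gamma_neg by simp
  then show ?thesis
    using assms by simp
qed

lemma line_energy_decreasing:
  assumes "x < y" "y \<le> 0"
  shows "line_energy y < line_energy x"
proof -
  have "y\<^sup>2 < x\<^sup>2"
    using assms power_strict_mono[of "- y" "- x" 2] by simp
  moreover have "\<gamma> * y < \<gamma> * x"
    using assms gamma_neg by simp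
  ultimately show ?thesis
    unfolding line_energy_def using F_strict_mono[of "\<gamma> * y" "\<gamma> * x"] by linarith
qed

text \<open>The slope of \<^term>\<open>line_energy\<close> is strictly increasing. Having returned to its value at \<open>0\<close>,
  the energy must have had a nonnegative slope earlier, and therefore has a positive slope from then on.\<close>

lemma line_energy_increasing:
  assumes "0 < x" "x < y" "s0 f \<le> line_energy x"
  shows "line_energy x < line_energy y"
proof -
  let ?D = "\<lambda>v. \<gamma> * f (\<gamma> * v) + v"
  obtain z where z: "0 < z" "z < x" "line_energy x - line_energy 0 = (x - 0) * ?D z"
    using MVT2[of 0 x line_energy ?D] line_energy_has_derivative assms(1) by auto
  obtain t where t: "x < t" "t < y" "line_energy y - line_energy x = (y - x) * ?D t"
    using MVT2[of x y line_energy ?D] line_energy_has_derivative assms(2) by auto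
  have "0 \<le> ?D z"
    using z assms zero_le_mult_iff[of x "?D z"] by (simp add: line_energy_0)
  then have "0 < ?D t"
    using line_energy_slope_strict_mono[of z t] z t by linarith
  then show ?thesis
    using t by (smt (verit) mult_pos_pos)
qed

text \<open>The slope at \<open>0\<close> is negative, because \<open>\<gamma> < 0\<close>. The energy therefore dips below
  \<open>s0 f\<close> on the positive axis before it grows beyond all bounds, and even for \<open>C = s0 f\<close> there is a
  positive root besides \<open>0\<close>.\<close>

lemma line_energy_roots:
  assumes "s0 f \<le> C"
  shows "\<exists>p q. p \<le> 0 \<and> 0 < q \<and> {v. line_energy v = C} = {p, q}"
proof -
  \<comment> \<open>beyond \<open>M\<close> the quadratic term alone exceeds \<open>C\<close>\<close>
  define M where "M = sqrt (2 * C) + 1"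
  have "0 < C"
    using assms F_pos[of 0] by (simp add: s0_def)
  then have "0 < M"
    by (simp add: M_def add_nonneg_pos)
  have "(sqrt (2 * C))\<^sup>2 < M\<^sup>2"
    using \<open>0 < C\<close> by (intro power_strict_mono) (auto simp: M_def)
  then have "2 * C < M\<^sup>2"
    using \<open>0 < C\<close> by simp
  then have big: "C \<le> line_energy v" if "\<bar>v\<bar> \<ge> M" for v
    using that F_pos[of "\<gamma> * v"] \<open>0 < M\<close> \<open>2 * C < M\<^sup>2\<close> power_mono[of M "\<bar>v\<bar>" 2]
    by (simp add: line_energy_def)
  obtain p where p: "-M \<le> p" "p \<le> 0" "line_energy p = C"
    using IVT2[of line_energy 0 C "-M"] big[of "-M"] assms \<open>0 < M\<close> isCont_line_energy
    by (auto simp: line_energy_0)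
  have "\<gamma> * f (\<gamma> * 0) + 0 < 0"
    using gamma_neg f_pos[of 0] by (simp add: mult_neg_pos)
  then obtain d where d: "d > 0" "\<And>h. 0 < h \<Longrightarrow> h < d \<Longrightarrow> line_energy (0 + h) < line_energy 0"
    using DERIV_neg_dec_right[OF line_energy_has_derivative, of 0] by auto
  \<comment> \<open>starting the intermediate value argument at \<open>e\<close> keeps it away from the root \<open>0\<close> when \<open>C = s0 f\<close>\<close>
  define e where "e = min (d / 2) M"
  have e: "0 < e" "e \<le> M" "line_energy e < s0 f"
    using d(1) \<open>0 < M\<close> d(2)[of e] by (auto simp: e_def line_energy_0)
  obtain q where q: "e \<le> q" "q \<le> M" "line_energy q = C"
    using IVT[of line_energy e C M] big[of M] e assms \<open>0 < M\<close> isCont_line_energy by auto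
  have "v = p \<or> v = q" if "line_energy v = C" for v
  proof (cases "v \<le> 0")
    case True
    then show ?thesis
      using line_energy_decreasing[of v p] line_energy_decreasing[of p v] p that
      by (cases v p rule: linorder_cases) auto
  next
    case False
    then show ?thesis
      using line_energy_increasing[of v q] line_energy_increasing[of q v] q e that assms
      by (cases v q rule: linorder_cases) auto
  qed
  then show ?thesis
    using p q e by (intro exI[of _ p] exI[of _ q]) auto
qed

lemma orbit_eq_iff:
  assumes "v\<^sup>2 < 2 * C"
  shows "orbit C v = u \<longleftrightarrow> F u + v\<^sup>2 / 2 = C"
proof -
  have "orbit C v = u \<longleftrightarrow> C - v\<^sup>2 / 2 = F u"
    using assms F_G[of "C - v\<^sup>2 / 2"] by (auto simp: orbit_def)
  then show ?thesis by auto
qed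

text \<open>This turns the extremal abscissae in the definitions of the end points into roots of an
  equation.\<close>

lemma line_meets_orbit: "fst ` (line_plus \<alpha> lam \<inter> curveK f C) = {v. line_energy v = C}"
proof -
  have *: "v\<^sup>2 < 2 * C" if "line_energy v = C" for v
    using that F_pos[of "\<gamma> * v"] by (auto simp: line_energy_def)
  have "fst ` (line_plus \<alpha> lam \<inter> curveK f C) = {v. v\<^sup>2 < 2 * C \<and> orbit C v = \<gamma> * v}"
    by (force simp: line_plus_def curveK_def orbit_def)
  also have "\<dots> = {v. line_energy v = C}"
    using * orbit_eq_iff by (auto simp: line_energy_def)
  finally show ?thesis .
qed

lemma endpoints:
  assumes "s0 f \<le> C"
  shows "0 \<le> a C" "0 < b C" "{v. line_energy v = C} = {- a C, b C}"
proof -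
  obtain p q where pq: "p \<le> 0" "0 < q" "{v. line_energy v = C} = {p, q}"
    using line_energy_roots assms by blast
  then have "b C = q" "- a C = p"
    by (simp_all add: v1_plus_def v2_minus_def v2_plus_def line_meets_orbit)
  with pq show "0 \<le> a C" "0 < b C" "{v. line_energy v = C} = {- a C, b C}"
    by auto
qed

lemma line_energy_endpoints:
  assumes "s0 f \<le> C"
  shows "line_energy (- a C) = C" "line_energy (b C) = C"
  using endpoints(3)[OF assms] by auto

lemma lower_endpoint_unique:
  assumes "s0 f \<le> C" "0 \<le> v" "line_energy (- v) = C"
  shows "a C = v"
proof -
  have "- v \<in> {- a C, b C}"
    using endpoints(3)[OF assms(1)] assms(3) by blast
  then show ?thesis
    using endpoints(2)[OF assms(1)] assms(2) by auto
qed

lemma upper_endpoint_unique: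
  assumes "s0 f \<le> C" "0 < v" "line_energy v = C"
  shows "b C = v"
proof -
  have "v \<in> {- a C, b C}"
    using endpoints(3)[OF assms(1)] assms(3) by blast
  then show ?thesis
    using endpoints(1)[OF assms(1)] assms(2) by auto
qed

lemma lower_endpoint_pos:
  assumes "s0 f < C"
  shows "0 < a C"
  using endpoints(1)[of C] line_energy_endpoints(1)[of C] assms line_energy_0
  by (cases "a C = 0") auto

lemma endpoint_power_bounds:
  assumes "s0 f \<le> C"
  shows "2 * (C - s0 f) \<le> (b C)\<^sup>2" "(b C)\<^sup>2 < 2 * C"
proof -
  have "\<gamma> * b C < 0"
    using endpoints(2)[OF assms] gamma_neg by (simp add: mult_neg_pos)
  then have "F (\<gamma> * b C) \<le> s0 f"
    by (simp add: s0_def F_le_iff)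
  then show "2 * (C - s0 f) \<le> (b C)\<^sup>2" "(b C)\<^sup>2 < 2 * C"
    using line_energy_endpoints(2)[OF assms] F_pos[of "\<gamma> * b C"] by (simp_all add: line_energy_def)
qed

lemma endpoints_less:
  assumes "s0 f \<le> C"
  shows "a C < b C"
proof -
  have "\<gamma> * b C < 0" "0 \<le> \<gamma> * (- a C)"
    using endpoints(1,2)[OF assms] gamma_neg by (auto simp: mult_neg_pos mult_nonpos_nonneg)
  then have "F (\<gamma> * b C) < F (\<gamma> * (- a C))"
    by (simp add: F_less_iff)
  then have "(a C)\<^sup>2 < (b C)\<^sup>2"
    using line_energy_endpoints[OF assms] by (simp add: line_energy_def)
  then show ?thesis
    using endpoints(2)[OF assms] by (meson less_imp_le power2_less_imp_less)
qed

lemma between_endpoints: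
  assumes "s0 f \<le> C" "v \<in> {a C..b C}"
  shows "v\<^sup>2 < 2 * C"
proof -
  have "v\<^sup>2 \<le> (b C)\<^sup>2"
    using endpoints(1)[OF assms(1)] assms(2) by (intro power_mono) auto
  then show ?thesis
    using endpoint_power_bounds(2)[OF assms(1)] by linarith
qed

lemma orbit_endpoints:
  assumes "s0 f \<le> C"
  shows "orbit C (a C) = - \<gamma> * a C" "orbit C (b C) = \<gamma> * b C"
  using line_energy_endpoints[OF assms] between_endpoints[OF assms] endpoints_less[OF assms]
  by (simp_all add: orbit_eq_iff line_energy_def)

lemma filterlim_lower_endpoint: "filterlim a at_top at_top"
  unfolding filterlim_at_top
proof
  fix Z
  show "\<forall>\<^sub>F C in at_top. Z \<le> a C"
    using eventually_ge_at_top[of "s0 f"] eventually_gt_at_top[of "line_energy (- Z)"]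
  proof eventually_elim
    case (elim C)
    then show ?case
      using line_energy_decreasing[of "- Z" "- a C"] endpoints(1)[of C] line_energy_endpoints(1)[of C]
      by force
  qed
qed

text \<open>With \<open>w = - \<gamma> * a C / 2\<close>, the bound \<open>w * f w \<le> F (2 * w) - F w\<close> and
  \<open>F (2 * w) \<le> C\<close> give \<open>w * f w \<le> C - s0 f \<le> (b C)\<^sup>2 / 2\<close>. As \<open>a C\<close> is a multiple of \<open>w\<close>,
  \<open>(a C / b C)\<^sup>2\<close> is bounded by a multiple of \<open>w / f w\<close>, which superlinearity sends to \<open>0\<close>.\<close>

lemma endpoint_ratio_tendsto_0: "((\<lambda>C. a C / b C) \<longlongrightarrow> 0) at_top"
proof -
  have "filterlim (\<lambda>C. - \<gamma> / 2 * a C) at_top at_top"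
    using gamma_neg by (intro filterlim_tendsto_pos_mult_at_top[OF tendsto_const _ filterlim_lower_endpoint]) simp
  from filterlim_compose[OF identity_over_f_tendsto_0 this]
  have "((\<lambda>C. sqrt (2 / \<gamma>\<^sup>2 * ((- \<gamma> / 2 * a C) / f (- \<gamma> / 2 * a C))))
      \<longlongrightarrow> sqrt (2 / \<gamma>\<^sup>2 * 0)) at_top"
    by (intro tendsto_intros)
  then have upper: "((\<lambda>C. sqrt (2 / \<gamma>\<^sup>2 * ((- \<gamma> / 2 * a C) / f (- \<gamma> / 2 * a C))))
      \<longlongrightarrow> 0) at_top"
    by simp
  show ?thesis
  proof (rule tendsto_sandwich[OF _ _ tendsto_const upper])
    show "\<forall>\<^sub>F C in at_top. 0 \<le> a C / b C"
      using eventually_ge_at_top[of "s0 f"] by eventually_elim (simp add: endpoints less_imp_le)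
    show "\<forall>\<^sub>F C in at_top. a C / b C
        \<le> sqrt (2 / \<gamma>\<^sup>2 * ((- \<gamma> / 2 * a C) / f (- \<gamma> / 2 * a C)))"
      using eventually_gt_at_top[of "s0 f"]
    proof eventually_elim
      case (elim C)
      define w where "w = - \<gamma> / 2 * a C"
      have a: "0 < a C" and b: "0 < b C"
        using lower_endpoint_pos endpoints(2) elim by auto
      have w: "0 < w"
        using a gamma_neg by (simp add: w_def mult_neg_pos)
      have "w * f w \<le> F (2 * w) - F w"
        using F_chord(1)[of w "2 * w"] w by simp
      also have "\<dots> \<le> F (2 * w) - s0 f"
        using w by (simp add: s0_def F_le_iff)
      also have "F (2 * w) \<le> C"
      proof -
        have "F (2 * w) + (a C)\<^sup>2 / 2 = C"
          using line_energy_endpoints(1)[of C] elim by (simp add: line_energy_def w_def)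
        then show ?thesis
          using zero_le_power2[of "a C"] by linarith
      qed
      also have "C - s0 f \<le> (b C)\<^sup>2 / 2"
        using endpoint_power_bounds(1)[of C] elim by simp
      finally have "2 * w * f w \<le> (b C)\<^sup>2"
        by simp
      then have "(a C / b C)\<^sup>2 \<le> (a C)\<^sup>2 / (2 * w * f w)"
        using w b f_pos[of w] by (auto simp: power_divide intro!: divide_left_mono mult_pos_pos)
      also have "\<dots> = 2 / \<gamma>\<^sup>2 * (w / f w)"
        using gamma_neg a f_pos[of w] by (simp add: w_def field_simps power2_eq_square)
      finally show ?case
        unfolding w_def by (rule real_le_rsqrt)
    qed
  qed
qed

section \<open>Time along an orbit\<close>

text \<open>The time \<open>- dx / dv\<close> that a solution of energy \<open>C\<close> spends per unit of \<open>v\<close>.\<close>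

definition time_density :: "real \<Rightarrow> real \<Rightarrow> real" where
  "time_density C v = 1 / (sqrt lam * f (orbit C v))"

lemma L12_eq: "L12 \<alpha> lam f C = integral {a C..b C} (time_density C)"
  by (simp add: L12_def time_density_def[abs_def] orbit_def)

lemma orbit_has_derivative:
  assumes "v\<^sup>2 < 2 * C"
  shows "(orbit C has_real_derivative - v / f (orbit C v)) (at v)"
proof -
  have "((\<lambda>v. C - v\<^sup>2 / 2) has_real_derivative - v) (at v)"
    by (auto intro!: derivative_eq_intros)
  moreover have "(G has_real_derivative 1 / f (orbit C v)) (at (C - v\<^sup>2 / 2))"
    using G_has_derivative[of "C - v\<^sup>2 / 2"] assms by (simp add: orbit_def)
  ultimately have "((\<lambda>v. G (C - v\<^sup>2 / 2)) has_real_derivative 1 / f (orbit C v) * - v) (at v)"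
    by (rule DERIV_chain2[rotated])
  then show ?thesis
    by (simp add: orbit_def[abs_def])
qed

lemma orbit_decreasing:
  assumes "0 \<le> v" "v < w" "w\<^sup>2 < 2 * C"
  shows "orbit C w < orbit C v"
proof -
  have "v\<^sup>2 < w\<^sup>2"
    using assms by (intro power_strict_mono) auto
  with assms(3) show ?thesis
    by (simp add: orbit_def G_less_iff)
qed

lemma isCont_time_density:
  assumes "v\<^sup>2 < 2 * C"
  shows "isCont (time_density C) v"
proof -
  have "isCont (\<lambda>v. f (orbit C v)) v"
    by (rule isCont_o2[OF DERIV_isCont[OF orbit_has_derivative[OF assms]] isCont_f])
  then show ?thesis
    unfolding time_density_def[abs_def] using f_pos[of "orbit C v"] lam_pos
    by (intro continuous_divide continuous_mult continuous_const) auto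
qed

lemma continuous_on_time_density:
  assumes "s0 f \<le> C"
  shows "continuous_on {a C..b C} (time_density C)"
  by (intro continuous_at_imp_continuous_on ballI isCont_time_density between_endpoints assms)

lemma time_density_pos: "0 < time_density C v"
  using f_pos lam_pos by (simp add: time_density_def)

lemma time_density_mono:
  assumes "0 \<le> v" "v \<le> w" "w\<^sup>2 < 2 * C"
  shows "time_density C v \<le> time_density C w"
proof -
  have "orbit C w \<le> orbit C v"
    using orbit_decreasing[of v w C] assms by (cases "v = w") auto
  then show ?thesis
    unfolding time_density_def using f_pos[of "orbit C v"] f_pos[of "orbit C w"] lam_pos
    by (intro divide_left_mono mult_left_mono f_mono) auto
qed

text \<open>The integrand is the derivative of \<open>- orbit C v / sqrt lam\<close>, and at the end points the orbit takes
  the values \<open>- \<gamma> * a C\<close> and \<open>\<gamma> * b C\<close> of the two lines. This exact identity drives both bounds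
  on the interval length.\<close>

lemma time_density_first_moment:
  assumes "s0 f \<le> C"
  shows "((\<lambda>v. v * time_density C v) has_integral - (1 / \<alpha>) * (a C + b C)) {a C..b C}"
proof -
  have "((\<lambda>v. v * time_density C v) has_integral (- orbit C (b C) / sqrt lam - - orbit C (a C) / sqrt lam)) {a C..b C}"
  proof (rule fundamental_theorem_of_calculus)
    show "a C \<le> b C"
      using endpoints_less[OF assms] by simp
    fix v assume "v \<in> {a C..b C}"
    then have "v\<^sup>2 < 2 * C"
      by (rule between_endpoints[OF assms])
    then have "((\<lambda>v. - orbit C v / sqrt lam) has_real_derivative - (- v / f (orbit C v)) / sqrt lam) (at v)"
      by (intro DERIV_cdivide DERIV_minus orbit_has_derivative)
    then have "((\<lambda>v. - orbit C v / sqrt lam) has_real_derivative v * time_density C v) (at v)"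
      by (simp add: time_density_def mult.commute)
    then show "((\<lambda>v. - orbit C v / sqrt lam) has_vector_derivative v * time_density C v) (at v within {a C..b C})"
      by (simp add: has_real_derivative_iff_has_vector_derivative has_vector_derivative_at_within)
  qed
  moreover have "- orbit C (b C) / sqrt lam - - orbit C (a C) / sqrt lam = - (1 / \<alpha>) * (a C + b C)"
    using lam_pos alpha_neg by (simp add: orbit_endpoints[OF assms] gamma_star_def field_simps)
  ultimately show ?thesis
    by simp
qed

section \<open>Bounds and limit of the interval length\<close>

text \<open>Replacing the weight \<open>v\<close> in the first moment by its maximum \<open>b C\<close> gives
  \<open>b C * L12 \<ge> - (1 / \<alpha>) * (a C + b C)\<close>; the strict inequality comes from \<open>a C > 0\<close>.\<close>

lemma L12_greater:
  assumes "s0 f < C"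
  shows "- (1 / \<alpha>) < L12 \<alpha> lam f C"
proof -
  have C: "s0 f \<le> C" using assms by simp
  have "(time_density C has_integral L12 \<alpha> lam f C) {a C..b C}"
    unfolding L12_eq using continuous_on_time_density[OF C] by (intro integrable_integral integrable_continuous_real)
  then have "((\<lambda>v. b C * time_density C v) has_integral b C * L12 \<alpha> lam f C) {a C..b C}"
    by (rule has_integral_mult_right)
  with time_density_first_moment[OF C] have "- (1 / \<alpha>) * (a C + b C) \<le> b C * L12 \<alpha> lam f C"
    by (rule has_integral_le) (simp add: mult_right_mono time_density_pos less_imp_le)
  moreover have "- (1 / \<alpha>) * b C < - (1 / \<alpha>) * (a C + b C)"
    using alpha_neg lower_endpoint_pos[OF assms] by (intro mult_strict_left_mono) auto
  ultimately have "b C * (- (1 / \<alpha>)) < b C * L12 \<alpha> lam f C"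
    by (metis mult.commute order_less_le_trans)
  then show ?thesis
    using endpoints(2)[OF C] by (simp only: mult_less_cancel_left_pos)
qed

text \<open>By monotonicity the density is at most its value at \<open>r * b C\<close> when \<open>v \<le> r * b C\<close>, and
  for larger \<open>v\<close> it is at most \<open>v * time_density C v / (r * b C)\<close>. The sum of the two bounds holds for
  all \<open>v\<close>, and its second term integrates to a multiple of the first moment.\<close>

lemma L12_upper_bound:
  assumes "s0 f \<le> C" "0 < r" "r < 1"
  shows "L12 \<alpha> lam f C \<le> b C * time_density C (r * b C) + (1 + a C / b C) * (- (1 / \<alpha>) / r)"
proof -
  define R where "R = time_density C (r * b C)"
  have a: "0 \<le> a C" and ab: "a C < b C" and b: "0 < b C"
    using endpoints[OF assms(1)] endpoints_less[OF assms(1)] by auto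
  have "(time_density C has_integral L12 \<alpha> lam f C) {a C..b C}"
    unfolding L12_eq using continuous_on_time_density[OF assms(1)]
    by (intro integrable_integral integrable_continuous_real)
  moreover have "((\<lambda>v. R + 1 / (r * b C) * (v * time_density C v)) has_integral
      (b C - a C) * R + 1 / (r * b C) * (- (1 / \<alpha>) * (a C + b C))) {a C..b C}"
    using ab has_integral_const_real[of R "a C" "b C"]
    by (intro has_integral_add has_integral_mult_right time_density_first_moment[OF assms(1)]) simp
  ultimately have "L12 \<alpha> lam f C \<le> (b C - a C) * R + 1 / (r * b C) * (- (1 / \<alpha>) * (a C + b C))"
  proof (rule has_integral_le)
    fix v assume v: "v \<in> {a C..b C}"
    have "R > 0" unfolding R_def by (rule time_density_pos)
    show "time_density C v \<le> R + 1 / (r * b C) * (v * time_density C v)"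
    proof (cases "v \<le> r * b C")
      case True
      have "r * b C \<in> {a C..b C} \<or> r * b C < a C"
        using assms b by auto
      with True v have "r * b C \<in> {a C..b C}" by auto
      then have "time_density C v \<le> R"
        unfolding R_def using True v a between_endpoints[OF assms(1)] by (intro time_density_mono) auto
      moreover have "0 \<le> 1 / (r * b C) * (v * time_density C v)"
        using v a b assms time_density_pos[of C v] by (intro mult_nonneg_nonneg) auto
      ultimately show ?thesis by linarith
    next
      case False
      then have "time_density C v * (r * b C) \<le> time_density C v * v"
        using time_density_pos[of C v] by (intro mult_left_mono) auto
      then have "time_density C v \<le> 1 / (r * b C) * (v * time_density C v)"
        using b assms by (simp add: field_simps)
      with \<open>R > 0\<close> show ?thesis by linarith
    qed
  qed
  also have "(b C - a C) * R \<le> b C * R"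
    using a time_density_pos[of C "r * b C"] by (simp add: R_def)
  also have "1 / (r * b C) * (- (1 / \<alpha>) * (a C + b C)) = (1 + a C / b C) * (- (1 / \<alpha>) / r)"
    using b assms alpha_neg by (simp add: field_simps)
  finally show ?thesis
    by (simp add: R_def)
qed

text \<open>The orbit at \<open>r * b C\<close> has height \<open>G y\<close> with \<open>y = C - (r * b C)\<^sup>2 / 2\<close>. Because \<open>r < 1\<close>, this
  \<open>y\<close> is of order \<open>C\<close> and \<open>(b C)\<^sup>2\<close> is at most a multiple of it. So the quantity is at most a
  multiple of \<open>sqrt (F u) / f u\<close> at \<open>u = G y\<close>, a height that tends to infinity.\<close>

lemma endpoint_times_time_density_tendsto_0:
  assumes "0 < r" "r < 1"
  shows "((\<lambda>C. b C * time_density C (r * b C)) \<longlongrightarrow> 0) at_top"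
proof -
  define y where "y C = C - (r * b C)\<^sup>2 / 2" for C
  have r: "0 < 1 - r\<^sup>2"
    using assms by (simp add: power_less_one_iff abs_square_less_1)
  have y: "(1 - r\<^sup>2) * C \<le> y C" "(1 - r\<^sup>2) * (b C)\<^sup>2 \<le> 2 * y C" if "s0 f \<le> C" for C
  proof -
    have "r\<^sup>2 * (b C)\<^sup>2 \<le> r\<^sup>2 * (2 * C)"
      using endpoint_power_bounds(2)[OF that] by (intro mult_left_mono) auto
    then show "(1 - r\<^sup>2) * C \<le> y C" "(1 - r\<^sup>2) * (b C)\<^sup>2 \<le> 2 * y C"
      using endpoint_power_bounds(2)[OF that] by (simp_all add: y_def power_mult_distrib algebra_simps)
  qed
  have "filterlim (\<lambda>C. (1 - r\<^sup>2) * C) at_top at_top"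
    using r by (intro filterlim_tendsto_pos_mult_at_top[OF tendsto_const _ filterlim_ident])
  then have "filterlim y at_top at_top"
  proof (rule filterlim_at_top_mono)
    show "\<forall>\<^sub>F C in at_top. (1 - r\<^sup>2) * C \<le> y C"
      using eventually_ge_at_top[of "s0 f"] by eventually_elim (rule y(1))
  qed
  then have "filterlim (\<lambda>C. G (y C)) at_top at_top"
    by (rule filterlim_compose[OF filterlim_G])
  from filterlim_compose[OF sqrt_F_over_f_tendsto_0 this]
  have "((\<lambda>C. sqrt (2 / (1 - r\<^sup>2)) / sqrt lam * (sqrt (F (G (y C))) / f (G (y C))))
      \<longlongrightarrow> sqrt (2 / (1 - r\<^sup>2)) / sqrt lam * 0) at_top"
    by (intro tendsto_intros)
  then have upper: "((\<lambda>C. sqrt (2 / (1 - r\<^sup>2)) / sqrt lam * (sqrt (F (G (y C))) / f (G (y C))))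
      \<longlongrightarrow> 0) at_top"
    by simp
  show ?thesis
  proof (rule tendsto_sandwich[OF _ _ tendsto_const upper])
    show "\<forall>\<^sub>F C in at_top. 0 \<le> b C * time_density C (r * b C)"
      using eventually_ge_at_top[of "s0 f"]
      by eventually_elim (simp add: endpoints time_density_pos less_imp_le)
    show "\<forall>\<^sub>F C in at_top. b C * time_density C (r * b C)
        \<le> sqrt (2 / (1 - r\<^sup>2)) / sqrt lam * (sqrt (F (G (y C))) / f (G (y C)))"
      using eventually_ge_at_top[of "s0 f"]
    proof eventually_elim
      case (elim C)
      have "0 < C"
        using elim F_pos[of 0] by (simp add: s0_def)
      then have "0 < y C"
        using y(1)[OF elim] r by (smt (verit) mult_pos_pos)
      have "(b C)\<^sup>2 \<le> 2 / (1 - r\<^sup>2) * y C"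
        using y(2)[OF elim] r by (simp add: field_simps)
      then have "b C \<le> sqrt (2 / (1 - r\<^sup>2) * y C)"
        by (rule real_le_rsqrt)
      also have "\<dots> = sqrt (2 / (1 - r\<^sup>2)) * sqrt (F (G (y C)))"
        using \<open>0 < y C\<close> by (simp only: F_G real_sqrt_mult)
      finally have upper: "b C \<le> sqrt (2 / (1 - r\<^sup>2)) * sqrt (F (G (y C)))" .
      have "b C * time_density C (r * b C) = b C / (sqrt lam * f (G (y C)))"
        by (simp add: time_density_def orbit_def y_def)
      also have "\<dots> \<le> sqrt (2 / (1 - r\<^sup>2)) * sqrt (F (G (y C))) / (sqrt lam * f (G (y C)))"
        using upper lam_pos f_pos[of "G (y C)"] by (intro divide_right_mono) auto
      finally show ?case
        by simp
    qed
  qed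
qed

lemma L12_tendsto: "((\<lambda>C. L12 \<alpha> lam f C) \<longlongrightarrow> - (1 / \<alpha>)) at_top"
proof (rule order_tendstoI)
  fix y assume "y < - (1 / \<alpha>)"
  then have "y < L12 \<alpha> lam f C" if "s0 f < C" for C
    using L12_greater[OF that] by simp
  then show "\<forall>\<^sub>F C in at_top. y < L12 \<alpha> lam f C"
    using eventually_gt_at_top[of "s0 f"] by (rule eventually_mono[rotated])
next
  fix y assume y: "- (1 / \<alpha>) < y"
  \<comment> \<open>\<open>r\<close> is chosen so that the limit \<open>- (1 / \<alpha>) / r\<close> of the upper bound is the midpoint \<open>z\<close>, below \<open>y\<close>\<close>
  define z where "z = (- (1 / \<alpha>) + y) / 2"
  define r where "r = - (1 / \<alpha>) / z"
  have pos: "0 < - (1 / \<alpha>)"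
    using alpha_neg by simp
  have z: "- (1 / \<alpha>) < z" "z < y"
    using y by (auto simp: z_def)
  then have r: "0 < r" "r < 1" "- (1 / \<alpha>) / r = z"
    using pos alpha_neg unfolding r_def by (simp_all add: field_simps)
  have "((\<lambda>C. b C * time_density C (r * b C) + (1 + a C / b C) * z) \<longlongrightarrow> 0 + (1 + 0) * z) at_top"
    by (intro tendsto_intros endpoint_times_time_density_tendsto_0 endpoint_ratio_tendsto_0 r)
  then have "\<forall>\<^sub>F C in at_top. b C * time_density C (r * b C) + (1 + a C / b C) * z < y"
    using z(2) by (intro order_tendstoD(2)) auto
  then show "\<forall>\<^sub>F C in at_top. L12 \<alpha> lam f C < y"
    using eventually_ge_at_top[of "s0 f"]
  proof eventually_elim
    case (elim C)
    have "L12 \<alpha> lam f C \<le> b C * time_density C (r * b C) + (1 + a C / b C) * z"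
      using L12_upper_bound[OF elim(2) r(1,2)] unfolding r(3) .
    with elim(1) show ?case
      by linarith
  qed
qed

section \<open>Continuity of the interval length\<close>

text \<open>An affine substitution moves the dependence on \<open>C\<close> from the interval into the integrand, where
  continuity of parameter integrals over a fixed interval applies.\<close>

lemma L12_eq_unit_interval:
  assumes "s0 f \<le> C"
  shows "L12 \<alpha> lam f C = integral {0..1} (\<lambda>t. (b C - a C) * time_density C (a C + t * (b C - a C)))"
proof -
  have ab: "a C < b C"
    by (rule endpoints_less[OF assms])
  have "((\<lambda>t. (b C - a C) *\<^sub>R time_density C (a C + t * (b C - a C)))
      has_integral (integral {a C + 0 * (b C - a C)..a C + 1 * (b C - a C)} (time_density C))) {0..1}"
  proof (rule has_integral_substitution)
    show "(\<lambda>t. a C + t * (b C - a C)) ` {0..1} \<subseteq> {a C..b C}"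
      using between_affine[OF ab] by blast
    show "((\<lambda>t. a C + t * (b C - a C)) has_real_derivative b C - a C) (at t within {0..1})" for t
      by (auto intro!: derivative_eq_intros)
  qed (use ab continuous_on_time_density[OF assms] in auto)
  then have "((\<lambda>t. (b C - a C) * time_density C (a C + t * (b C - a C))) has_integral L12 \<alpha> lam f C) {0..1}"
    by (simp add: L12_eq)
  then show ?thesis
    by (rule integral_unique[symmetric])
qed

text \<open>Each end point inverts a continuous injection on a compact interval, hence is continuous in \<open>C\<close>.
  Compactness also covers the left end \<open>C = s0 f\<close>, where both branches start and only one-sided
  neighbourhoods are available.\<close>

lemma continuous_on_endpoints:
  shows "continuous_on {s0 f..K} a" "continuous_on {s0 f..K} b"
proof -
  have "continuous_on {s0 f..K} a \<and> continuous_on {s0 f..K} b"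
  proof (cases "s0 f \<le> K")
    case True
    have "continuous_on ((\<lambda>v. line_energy (- v)) ` {0..a K}) a"
    proof (rule continuous_on_inv)
      show "continuous_on {0..a K} (\<lambda>v. line_energy (- v))"
        by (intro continuous_at_imp_continuous_on ballI isCont_o2[OF _ isCont_line_energy]) simp
      show "\<forall>v\<in>{0..a K}. a (line_energy (- v)) = v"
      proof
        fix v assume "v \<in> {0..a K}"
        then have "s0 f \<le> line_energy (- v)"
          using line_energy_decreasing[of "- v" 0] by (cases "v = 0") (auto simp: line_energy_0)
        then show "a (line_energy (- v)) = v"
          using \<open>v \<in> {0..a K}\<close> by (intro lower_endpoint_unique) auto
      qed
    qed simp
    moreover have "{s0 f..K} \<subseteq> (\<lambda>v. line_energy (- v)) ` {0..a K}"
    proof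
      fix C assume C: "C \<in> {s0 f..K}"
      then have "a C \<le> a K"
        using line_energy_decreasing[of "- a C" "- a K"] endpoints(1)[of K] True
          line_energy_endpoints(1)[of C] line_energy_endpoints(1)[of K] by force
      then show "C \<in> (\<lambda>v. line_energy (- v)) ` {0..a K}"
        using C endpoints(1)[of C] line_energy_endpoints(1)[of C] by force
    qed
    ultimately have 1: "continuous_on {s0 f..K} a"
      by (rule continuous_on_subset)
    have b0: "0 < b (s0 f)" "line_energy (b (s0 f)) = s0 f"
      using endpoints(2) line_energy_endpoints(2) by auto
    have "continuous_on (line_energy ` {b (s0 f)..b K}) b"
    proof (rule continuous_on_inv)
      show "continuous_on {b (s0 f)..b K} line_energy"
        by (intro continuous_at_imp_continuous_on ballI isCont_line_energy)
      show "\<forall>v\<in>{b (s0 f)..b K}. b (line_energy v) = v"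
      proof
        fix v assume v: "v \<in> {b (s0 f)..b K}"
        then have "s0 f \<le> line_energy v"
          using line_energy_increasing[of "b (s0 f)" v] b0 by (cases "v = b (s0 f)") auto
        then show "b (line_energy v) = v"
          using v b0 by (intro upper_endpoint_unique) auto
      qed
    qed simp
    moreover have "{s0 f..K} \<subseteq> line_energy ` {b (s0 f)..b K}"
    proof
      fix C assume C: "C \<in> {s0 f..K}"
      have mono: "b D \<le> b E" if "s0 f \<le> D" "D \<le> E" for D E
        using line_energy_increasing[of "b E" "b D"] endpoints(2)[of E] that
          line_energy_endpoints(2)[of D] line_energy_endpoints(2)[of E] by force
      then have "b C \<in> {b (s0 f)..b K}"
        using C by auto
      then show "C \<in> line_energy ` {b (s0 f)..b K}"
        using C line_energy_endpoints(2)[of C] by force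
    qed
    ultimately have "continuous_on {s0 f..K} b"
      by (rule continuous_on_subset)
    with 1 show ?thesis by simp
  qed auto
  then show "continuous_on {s0 f..K} a" "continuous_on {s0 f..K} b"
    by auto
qed

lemma continuous_on_L12: "continuous_on {s0 f..K} (\<lambda>C. L12 \<alpha> lam f C)"
proof -
  let ?v = "\<lambda>(C, t). a C + t * (b C - a C)"
  let ?S = "{s0 f..K} \<times> cbox 0 (1::real)"
  have ends: "continuous_on ?S (\<lambda>p. a (fst p))" "continuous_on ?S (\<lambda>p. b (fst p))"
    by (auto intro!: continuous_on_compose2[OF continuous_on_endpoints(1)]
        continuous_on_compose2[OF continuous_on_endpoints(2)] continuous_on_fst continuous_on_id)
  have v: "continuous_on ?S ?v"
    unfolding case_prod_beta by (intro continuous_intros ends)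
  have "(?v p)\<^sup>2 < 2 * fst p" if "p \<in> ?S" for p
  proof (rule between_endpoints)
    show "s0 f \<le> fst p" using that by auto
    then show "?v p \<in> {a (fst p)..b (fst p)}"
      using that between_affine[OF endpoints_less[of "fst p"], of "snd p"]
      by (auto simp: case_prod_beta)
  qed
  then have arg: "(\<lambda>p. fst p - (?v p)\<^sup>2 / 2) ` ?S \<subseteq> {0<..}"
    by force
  have "continuous_on {0<..} G"
    by (intro continuous_at_imp_continuous_on ballI isCont_G) simp
  moreover have "continuous_on ?S (\<lambda>p. fst p - (?v p)\<^sup>2 / 2)"
    by (intro continuous_on_diff continuous_on_divide continuous_on_power v continuous_on_fst
        continuous_on_id continuous_on_const) simp
  ultimately have "continuous_on ?S (\<lambda>p. G (fst p - (?v p)\<^sup>2 / 2))"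
    using arg by (rule continuous_on_compose2)
  with continuous_on_f[of UNIV] have "continuous_on ?S (\<lambda>p. f (G (fst p - (?v p)\<^sup>2 / 2)))"
    by (rule continuous_on_compose2) simp
  moreover have "sqrt lam * f u \<noteq> 0" for u
    using lam_pos f_pos[of u] by simp
  ultimately have "continuous_on ?S
      (\<lambda>p. (b (fst p) - a (fst p)) * (1 / (sqrt lam * f (G (fst p - (?v p)\<^sup>2 / 2)))))"
    by (intro continuous_on_mult continuous_on_divide continuous_on_diff continuous_on_const ends ballI)
  then have "continuous_on ?S (\<lambda>(C, t). (b C - a C) * time_density C (a C + t * (b C - a C)))"
    by (simp add: time_density_def orbit_def case_prod_beta)
  then have "continuous_on {s0 f..K} (\<lambda>C. integral (cbox 0 1)
      (\<lambda>t. (b C - a C) * time_density C (a C + t * (b C - a C))))"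
    by (rule integral_continuous_on_param)
  then show ?thesis
    by (rule continuous_on_eq) (simp add: L12_eq_unit_interval)
qed

lemma exists_energy_of_length:
  assumes "- (1 / \<alpha>) < L" "L < L12 \<alpha> lam f (s0 f)"
  shows "\<exists>C \<ge> s0 f. L12 \<alpha> lam f C = L"
proof -
  have "\<forall>\<^sub>F C in at_top. L12 \<alpha> lam f C < L"
    using L12_tendsto assms(1) by (rule order_tendstoD(2))
  then have "\<forall>\<^sub>F C in at_top. L12 \<alpha> lam f C < L \<and> s0 f \<le> C"
    using eventually_ge_at_top by (rule eventually_conj)
  then obtain K where "L12 \<alpha> lam f K < L" "s0 f \<le> K"
    using eventually_happens'[OF trivial_limit_at_top_linorder] by blast
  then show ?thesis
    using IVT2'[of "\<lambda>C. L12 \<alpha> lam f C" K L "s0 f"] assms(2) continuous_on_L12 by auto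
qed

section \<open>Solutions from orbits\<close>

text \<open>Room beyond \<open>b C\<close> makes the derivatives at the end points of the trajectory two-sided.\<close>

lemma upper_endpoint_margin:
  assumes "s0 f \<le> C"
  obtains m where "b C < m" "m\<^sup>2 < 2 * C"
proof -
  have "b C < sqrt (2 * C)"
    using endpoint_power_bounds(2)[OF assms] by (rule real_less_rsqrt)
  then obtain m where m: "b C < m" "m < sqrt (2 * C)"
    using dense by blast
  have "0 < C"
    using assms F_pos[of 0] by (simp add: s0_def)
  have "m\<^sup>2 < (sqrt (2 * C))\<^sup>2"
    using m endpoints(2)[OF assms] by (intro power_strict_mono) auto
  then show ?thesis
    using that m(1) \<open>0 < C\<close> by simp
qed

text \<open>The equation \<open>v' = - sqrt lam * f (orbit C v)\<close> separates: if \<open>A\<close> is an antiderivative of the time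
  density, then \<open>A (v x) + x\<close> is constant. The trajectory is therefore obtained by inverting \<open>A\<close>.\<close>

lemma velocity_trajectory:
  assumes "s0 f \<le> C"
  obtains v where "v 0 = b C" "v (L12 \<alpha> lam f C) = a C"
    and "\<And>x. x \<in> {0..L12 \<alpha> lam f C} \<Longrightarrow> v x \<in> {a C..b C}"
    and "\<And>x. x \<in> {0..L12 \<alpha> lam f C} \<Longrightarrow>
           (v has_real_derivative - sqrt lam * f (orbit C (v x))) (at x)"
proof -
  obtain m where m: "b C < m" "m\<^sup>2 < 2 * C"
    using upper_endpoint_margin assms by blast
  have a: "0 \<le> a C" and ab: "a C < b C"
    using endpoints(1)[OF assms] endpoints_less[OF assms] by auto
  obtain m' where m': "b C < m'" "m' < m"
    using dense m(1) by blast
  have strip: "v\<^sup>2 < 2 * C" if "v \<in> {- m..m}" for v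
  proof -
    have "\<bar>v\<bar>\<^sup>2 \<le> m\<^sup>2"
      using that by (intro power_mono) auto
    then show ?thesis
      using m(2) by simp
  qed
  define A where "A v = integral {- m..v} (time_density C)" for v
  have cont: "continuous_on {- m..m} (time_density C)"
    by (intro continuous_at_imp_continuous_on ballI isCont_time_density strip)
  have A: "(A has_real_derivative time_density C v) (at v)" if "v \<in> {- m'..m'}" for v
  proof -
    have "v \<in> interior {- m..m}"
      using that m' by auto
    then have "at v within {- m..m} = at v"
      by (rule at_within_interior)
    then show ?thesis
      using integral_has_real_derivative[OF cont, of v] that m' by (simp add: A_def[abs_def])
  qed
  obtain B where BA: "\<And>v. v \<in> {- m'..m'} \<Longrightarrow> B (A v) = v"
    and B: "\<And>v. v \<in> {- m'<..<m'} \<Longrightarrow> (B has_real_derivative 1 / time_density C v) (at (A v))"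
    using real_inverse_of_increasing[OF A time_density_pos] by blast
  have A_diff: "A (b C) - A (a C) = L12 \<alpha> lam f C"
  proof -
    have "time_density C integrable_on {- m..b C}"
      using cont m(1) by (intro integrable_continuous_real) (auto elim: continuous_on_subset)
    then have "A (a C) + L12 \<alpha> lam f C = A (b C)"
      unfolding A_def L12_eq using a ab m(1) by (intro Henstock_Kurzweil_Integration.integral_combine) auto
    then show ?thesis by simp
  qed
  have isCont_A: "isCont A v" if "v \<in> {a C..b C}" for v
    using that a m'(1) by (intro DERIV_isCont[OF A]) auto
  have reach: "\<exists>v\<in>{a C..b C}. A v = A (b C) - x" if "x \<in> {0..L12 \<alpha> lam f C}" for x
    using IVT[of A "a C" "A (b C) - x" "b C"] that A_diff ab isCont_A by auto
  define v where "v x = B (A (b C) - x)" for x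
  have vx: "v x \<in> {a C..b C} \<and> A (v x) = A (b C) - x" if x: "x \<in> {0..L12 \<alpha> lam f C}" for x
  proof -
    obtain w where w: "w \<in> {a C..b C}" "A w = A (b C) - x"
      using reach[OF x] by blast
    then have "v x = w"
      using BA[of w] a m'(1) by (simp add: v_def)
    with w show ?thesis by simp
  qed
  show thesis
  proof
    show "v 0 = b C" "v (L12 \<alpha> lam f C) = a C"
      using BA[of "b C"] BA[of "a C"] a ab m'(1) by (simp_all add: v_def flip: A_diff)
    fix x assume x: "x \<in> {0..L12 \<alpha> lam f C}"
    show "v x \<in> {a C..b C}"
      using vx[OF x] by simp
    have "(B has_real_derivative 1 / time_density C (v x)) (at (A (b C) - x))"
      using B[of "v x"] vx[OF x] a m'(1) by auto
    moreover have "((\<lambda>x. A (b C) - x) has_real_derivative - 1) (at x)"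
      by (auto intro!: derivative_eq_intros)
    ultimately have "((\<lambda>x. B (A (b C) - x)) has_real_derivative 1 / time_density C (v x) * - 1) (at x)"
      by (rule DERIV_chain2)
    then show "(v has_real_derivative - sqrt lam * f (orbit C (v x))) (at x)"
      by (simp add: v_def[abs_def] time_density_def)
  qed
qed

text \<open>For \<open>u x = orbit C (v x)\<close> the chain rule cancels \<open>f\<close> in \<open>u'\<close>, leaving \<open>u' = sqrt lam * v\<close> and thus
  \<open>u'' = - lam * f u\<close>. The boundary conditions hold because the orbit meets the two lines at \<open>b C\<close> and
  \<open>a C\<close>.\<close>

lemma exists_increasing_solution:
  assumes "s0 f \<le> C"
  shows "\<exists>u. increasing_robin_solution \<alpha> lam f (L12 \<alpha> lam f C) u"
proof -
  let ?L = "L12 \<alpha> lam f C"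
  obtain v where v0: "v 0 = b C" and vL: "v ?L = a C"
    and v: "\<And>x. x \<in> {0..?L} \<Longrightarrow> v x \<in> {a C..b C}"
    and v': "\<And>x. x \<in> {0..?L} \<Longrightarrow> (v has_real_derivative - sqrt lam * f (orbit C (v x))) (at x)"
    using velocity_trajectory[OF assms] by blast
  define u where "u x = orbit C (v x)" for x
  have u: "(u has_real_derivative sqrt lam * v x) (at x)" if "x \<in> {0..?L}" for x
  proof -
    have "(orbit C has_real_derivative - v x / f (orbit C (v x))) (at (v x))"
      using v[OF that] by (intro orbit_has_derivative between_endpoints[OF assms])
    then have "((\<lambda>x. orbit C (v x)) has_real_derivative
        - v x / f (orbit C (v x)) * (- sqrt lam * f (orbit C (v x)))) (at x)"
      using v'[OF that] by (rule DERIV_chain2)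
    then show ?thesis
      using f_pos[of "orbit C (v x)"] by (simp add: u_def[abs_def] mult.commute)
  qed
  have "robin_solution \<alpha> lam f ?L u"
    unfolding robin_solution_def
  proof (rule exI[of _ "\<lambda>x. sqrt lam * v x"], rule exI[of _ "\<lambda>x. sqrt lam * (- sqrt lam * f (u x))"],
      intro conjI ballI)
    show "continuous_on {0..?L} (\<lambda>x. sqrt lam * v x)"
      by (intro continuous_at_imp_continuous_on ballI continuous_mult continuous_const DERIV_isCont[OF v'])
    show "sqrt lam * v 0 = \<alpha> * u 0" "sqrt lam * v ?L = - \<alpha> * u ?L"
      using alpha_neg by (simp_all add: u_def v0 vL orbit_endpoints[OF assms] gamma_star_def)
    fix x
    assume "x \<in> {0..?L}"
    then show "(u has_real_derivative sqrt lam * v x) (at x within {0..?L})"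
      by (rule has_field_derivative_at_within[OF u])
  next
    fix x
    assume "x \<in> {0<..<?L}"
    then show "((\<lambda>x. sqrt lam * v x) has_real_derivative sqrt lam * (- sqrt lam * f (u x))) (at x)"
      unfolding u_def by (intro DERIV_cmult v') auto
    show "sqrt lam * (- sqrt lam * f (u x)) + lam * f (u x) = 0"
      using lam_pos by simp
  qed
  moreover have "strict_mono_on {0..?L} u"
  proof (rule strict_mono_onI)
    fix x y assume xy: "x \<in> {0..?L}" "y \<in> {0..?L}" "x < y"
    have "v y < v x"
    proof (rule DERIV_neg_imp_decreasing[OF xy(3)])
      fix z assume "x \<le> z" "z \<le> y"
      then show "\<exists>d. (v has_real_derivative d) (at z) \<and> d < 0"
        using xy lam_pos f_pos v'[of z] by (intro exI[of _ "- sqrt lam * f (orbit C (v z))"]) auto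
    qed
    then show "u x < u y"
      using v[OF xy(1)] v[OF xy(2)] endpoints(1)[OF assms] between_endpoints[OF assms, of "v x"]
      unfolding u_def by (intro orbit_decreasing) auto
  qed
  ultimately show ?thesis
    unfolding increasing_robin_solution_def by blast
qed

section \<open>Orbits from solutions\<close>

lemma velocity_decreasing:
  assumes "0 < L"
    and cont: "continuous_on {0..L} u'"
    and deriv: "\<And>x. x \<in> {0<..<L} \<Longrightarrow> (u' has_real_derivative - lam * f (u x)) (at x)"
    and "0 \<le> x" "x < y" "y \<le> L"
  shows "u' y < u' x"
proof (rule DERIV_neg_imp_decreasing_open[OF \<open>x < y\<close>])
  fix z assume "x < z" "z < y"
  then show "\<exists>d. (u' has_real_derivative d) (at z) \<and> d < 0"
    using deriv[of z] assms(4,6) lam_pos f_pos by (intro exI[of _ "- lam * f (u z)"]) auto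
next
  show "continuous_on {x..y} u'"
    using assms(4,6) by (intro continuous_on_subset[OF cont]) auto
qed

text \<open>Conservation of energy places the solution on a curve. Its velocity is strictly decreasing by the
  equation and nonnegative at the end by monotonicity; so the boundary conditions give a positive root
  of \<^term>\<open>line_energy\<close> at \<open>x = 0\<close> and a nonpositive one at \<open>x = L\<close>, which identifies the end points and
  forces \<open>s0 f \<le> C\<close>. Finally the time integral from \<open>v x\<close> to \<open>b C\<close> grows at unit rate in \<open>x\<close>.\<close>

lemma increasing_solution_is_orbit:
  assumes u: "increasing_robin_solution \<alpha> lam f L u" and L: "0 < L"
  obtains C v where "s0 f \<le> C" "L12 \<alpha> lam f C = L"
    and "\<And>x. x \<in> {0..L} \<Longrightarrow> v x \<in> {a C..b C}"
    and "\<And>x. x \<in> {0..L} \<Longrightarrow> u x = orbit C (v x)"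
    and "\<And>x. x \<in> {0..L} \<Longrightarrow> integral {v x..b C} (time_density C) = x"
proof -
  obtain u' u'' where du: "\<And>x. x \<in> {0..L} \<Longrightarrow> (u has_real_derivative u' x) (at x within {0..L})"
    and cont_u': "continuous_on {0..L} u'"
    and u'': "\<And>x. x \<in> {0<..<L} \<Longrightarrow> (u' has_real_derivative u'' x) (at x) \<and> u'' x + lam * f (u x) = 0"
    and bc: "u' 0 = \<alpha> * u 0" "u' L = - \<alpha> * u L"
    and mono: "strict_mono_on {0..L} u"
    using u unfolding increasing_robin_solution_def robin_solution_def by blast
  have du': "(u' has_real_derivative - lam * f (u x)) (at x)" if "x \<in> {0<..<L}" for x
  proof -
    have "u'' x = - lam * f (u x)"
      using u''[OF that] by linarith
    then show ?thesis
      using u''[OF that] by metis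
  qed
  have du_at: "(u has_real_derivative u' x) (at x)" if "x \<in> {0<..<L}" for x
    using du[of x] that at_within_interior[of x "{0..L}"] by auto
  have cont_u: "continuous_on {0..L} u"
    using du by (rule DERIV_continuous_on)
  define v where "v x = u' x / sqrt lam" for x
  have u'_v: "u' x = sqrt lam * v x" for x
    using lam_pos by (simp add: v_def)
  have v_less: "v y < v x" if "0 \<le> x" "x < y" "y \<le> L" for x y
    using velocity_decreasing[OF L cont_u' du' that] lam_pos
    by (simp add: v_def divide_strict_right_mono)
  have cont_v: "continuous_on {0..L} v"
    unfolding v_def[abs_def] using lam_pos by (intro continuous_on_divide cont_u' continuous_on_const) auto
  have dv: "(v has_real_derivative - sqrt lam * f (u x)) (at x)" if "x \<in> {0<..<L}" for x
  proof -
    have "- lam * f (u x) / sqrt lam = - (lam / sqrt lam) * f (u x)"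
      by simp
    also have "lam / sqrt lam = sqrt lam"
      using lam_pos by (simp add: real_div_sqrt)
    finally show ?thesis
      using DERIV_cdivide[OF du'[OF that], of "sqrt lam"] by (simp add: v_def[abs_def])
  qed
  have "0 \<le> u' L"
  proof (rule continuous_ge_on_closure[of "{0<..<L}" u'])
    show "continuous_on (closure {0<..<L}) u'" "L \<in> closure {0<..<L}"
      using L cont_u' by auto
    fix x assume x: "x \<in> {0<..<L}"
    then have "x \<in> interior {0..L}"
      by simp
    then show "0 \<le> u' x"
      by (rule mono_on_imp_deriv_nonneg[OF strict_mono_on_imp_mono_on[OF mono] du_at[OF x]])
  qed
  then have vL: "0 \<le> v L"
    using lam_pos by (simp add: v_def)
  have v0: "0 < v 0"
    using v_less[of 0 L] vL L by simp
  define C where "C = F (u 0) + (v 0)\<^sup>2 / 2"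
  have energy: "F (u x) + (v x)\<^sup>2 / 2 = C" if "x \<in> {0..L}" for x
    unfolding C_def
  proof (rule DERIV_isconst2[OF L])
    show "continuous_on {0..L} (\<lambda>x. F (u x) + (v x)\<^sup>2 / 2)"
    proof (intro continuous_on_add continuous_on_divide continuous_on_power cont_v continuous_on_const)
      show "continuous_on {0..L} (\<lambda>x. F (u x))"
        by (rule continuous_on_compose2[OF _ cont_u, of UNIV])
          (auto intro: continuous_at_imp_continuous_on isCont_F)
    qed simp
    fix x assume "0 < x" "x < L"
    then have x: "x \<in> {0<..<L}" by simp
    have "((\<lambda>x. F (u x)) has_real_derivative f (u x) * u' x) (at x)"
      by (rule DERIV_chain2[OF F_has_derivative du_at[OF x]])
    then have total: "((\<lambda>x. F (u x) + (v x)\<^sup>2 / 2) has_real_derivative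
        f (u x) * u' x + v x * (- sqrt lam * f (u x))) (at x)"
      using dv[OF x] by (auto intro!: derivative_eq_intros)
    have zero: "f (u x) * u' x + v x * (- sqrt lam * f (u x)) = 0"
      by (simp add: u'_v)
    show "((\<lambda>x. F (u x) + (v x)\<^sup>2 / 2) has_real_derivative 0) (at x)"
      using total unfolding zero .
  qed (use that in auto)
  have "u 0 = \<gamma> * v 0" "u L = - \<gamma> * v L"
    using bc alpha_neg by (simp_all add: u'_v gamma_star_def field_simps)
  then have line: "line_energy (v 0) = C" "line_energy (- v L) = C"
    using energy[of 0] energy[of L] L by (simp_all add: line_energy_def)
  have C: "s0 f \<le> C"
    using line_energy_decreasing[of "- v L" 0] line(2) vL
    by (cases "v L = 0") (auto simp: line_energy_0)
  have ends: "v 0 = b C" "v L = a C"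
    using upper_endpoint_unique[OF C v0 line(1)] lower_endpoint_unique[OF C vL line(2)] by auto
  have v_mem: "v x \<in> {a C..b C}" if "x \<in> {0..L}" for x
    using v_less[of 0 x] v_less[of x L] that
    unfolding ends[symmetric] by (cases "x = 0"; cases "x = L") auto
  have v_inner: "v x \<in> {a C<..<b C}" if "x \<in> {0<..<L}" for x
    using v_less[of 0 x] v_less[of x L] that unfolding ends[symmetric] by auto
  have u_orbit: "u x = orbit C (v x)" if "x \<in> {0..L}" for x
    using orbit_eq_iff[OF between_endpoints[OF C v_mem[OF that]], THEN iffD2, OF energy[OF that]]
    by (rule sym)
  have time: "integral {v x..b C} (time_density C) = x" if "x \<in> {0..L}" for x
  proof -
    let ?T = "\<lambda>w. integral {w..b C} (time_density C)"
    have dT: "(?T has_real_derivative - time_density C w) (at w within {a C..b C})" if "w \<in> {a C..b C}" for w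
      using that by (rule integral_has_real_derivative'[OF continuous_on_time_density[OF C]])
    have "?T (v x) - x = ?T (v 0) - 0"
    proof (rule DERIV_isconst2[OF L])
      have "continuous_on {0..L} (\<lambda>x. ?T (v x))"
        by (rule continuous_on_compose2[OF DERIV_continuous_on[OF dT] cont_v]) (use v_mem in auto)
      then show "continuous_on {0..L} (\<lambda>x. ?T (v x) - x)"
        by (intro continuous_on_diff continuous_on_id)
      fix x assume "0 < x" "x < L"
      then have x: "x \<in> {0<..<L}" by simp
      have "(?T has_real_derivative - time_density C (v x)) (at (v x))"
        using dT[of "v x"] v_inner[OF x] at_within_interior[of "v x" "{a C..b C}"] by auto
      then have "((\<lambda>x. ?T (v x)) has_real_derivative
          - time_density C (v x) * (- sqrt lam * f (u x))) (at x)"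
        using dv[OF x] by (rule DERIV_chain2)
      moreover have "- time_density C (v x) * (- sqrt lam * f (u x)) = 1"
        using lam_pos f_pos[of "orbit C (v x)"] u_orbit[of x] x by (simp add: time_density_def field_simps)
      ultimately have "((\<lambda>x. ?T (v x)) has_real_derivative 1) (at x)"
        by simp
      from DERIV_diff[OF this DERIV_ident] show "((\<lambda>x. ?T (v x) - x) has_real_derivative 0) (at x)"
        by simp
    qed (use that in auto)
    then show ?thesis
      by (simp add: ends)
  qed
  show thesis
    using that[OF C _ v_mem u_orbit time] time[of L] L by (simp add: ends L12_eq)
qed

lemma elapsed_time_inj:
  assumes "s0 f \<le> C" "p \<in> {a C..b C}" "q \<in> {a C..b C}"
    and "integral {p..b C} (time_density C) = integral {q..b C} (time_density C)"
  shows "p = q"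
proof -
  have less: "integral {q..b C} (time_density C) < integral {p..b C} (time_density C)"
    if "p < q" "p \<in> {a C..b C}" "q \<in> {a C..b C}" for p q
  proof -
    have cont: "continuous_on {p..b C} (time_density C)"
      using that continuous_on_time_density[OF assms(1)] by (auto elim: continuous_on_subset)
    have "integral {p..q} (time_density C) + integral {q..b C} (time_density C) = integral {p..b C} (time_density C)"
      using that cont
      by (intro Henstock_Kurzweil_Integration.integral_combine integrable_continuous_real) auto
    moreover have "integral {p..q} (\<lambda>_. 0) < integral {p..q} (time_density C)"
      using that by (intro integral_less_real time_density_pos continuous_on_const continuous_on_subset[OF cont]) auto
    ultimately show ?thesis by simp
  qed
  show ?thesis
    using less[of p q] less[of q p] assms by (cases p q rule: linorder_cases) auto
qed

text \<open>Both solutions have an energy at which \<open>L12\<close> equals \<open>L\<close>. It is not \<open>s0 f\<close>, where \<open>L12\<close> exceeds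
  \<open>L\<close>, so strict monotonicity beyond \<open>s0 f\<close> identifies the two energies; then the elapsed time
  determines the velocity at each \<open>x\<close>.\<close>

lemma increasing_solution_unique:
  assumes L: "0 < L" "L < L12 \<alpha> lam f (s0 f)"
    and decreasing: "strict_antimono_on {s0 f<..} (\<lambda>C. L12 \<alpha> lam f C)"
    and u: "increasing_robin_solution \<alpha> lam f L u" and w: "increasing_robin_solution \<alpha> lam f L w"
    and x: "x \<in> {0..L}"
  shows "w x = u x"
proof -
  obtain C v where C: "s0 f \<le> C" "L12 \<alpha> lam f C = L"
    and v: "\<And>x. x \<in> {0..L} \<Longrightarrow> v x \<in> {a C..b C}"
      "\<And>x. x \<in> {0..L} \<Longrightarrow> u x = orbit C (v x)"
      "\<And>x. x \<in> {0..L} \<Longrightarrow> integral {v x..b C} (time_density C) = x"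
    using increasing_solution_is_orbit[OF u L(1)] by blast
  obtain D y where D: "s0 f \<le> D" "L12 \<alpha> lam f D = L"
    and y: "\<And>x. x \<in> {0..L} \<Longrightarrow> y x \<in> {a D..b D}"
      "\<And>x. x \<in> {0..L} \<Longrightarrow> w x = orbit D (y x)"
      "\<And>x. x \<in> {0..L} \<Longrightarrow> integral {y x..b D} (time_density D) = x"
    using increasing_solution_is_orbit[OF w L(1)] by blast
  have "s0 f < C" "s0 f < D"
    using C D L(2) by (auto simp: order.strict_iff_order)
  then have "C = D"
    using monotone_onD[OF decreasing, of C D] monotone_onD[OF decreasing, of D C] C(2) D(2)
    by (metis \<open>s0 f < C\<close> \<open>s0 f < D\<close> greaterThan_iff linorder_neqE order_less_irrefl)
  note y_C = y[folded this]
  have "y x = v x"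
    using elapsed_time_inj[OF C(1) y_C(1)[OF x] v(1)[OF x]] y_C(3)[OF x] v(3)[OF x] by metis
  then show ?thesis
    using v(2)[OF x] y_C(2)[OF x] by metis
qed

end

section \<open>Length and increasing solutions\<close>

theorem theorem3p20:
  fixes \<alpha> lam :: real and f :: "real \<Rightarrow> real"
  assumes "\<alpha> < 0" and "lam > 0"
    and "f C1_differentiable_on UNIV"
    and "\<forall>u. f u > 0"
    and "\<forall>u. deriv f u \<ge> 0"
    and "filterlim (\<lambda>u. f u / u) at_top at_top"
    and "f integrable_on {..0}"
  shows "(\<forall>C > s0 f. L12 \<alpha> lam f C > - (1 / \<alpha>))
    \<and> ((\<lambda>C. L12 \<alpha> lam f C) \<longlongrightarrow> - (1 / \<alpha>)) at_top
    \<and> (antimono_on {s0 f<..} (\<lambda>C. L12 \<alpha> lam f C) \<longrightarrow>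
        (\<forall>L\<in>{- (1 / \<alpha>)<..<L12 \<alpha> lam f (s0 f)}.
          \<exists>u. increasing_robin_solution \<alpha> lam f L u))
    \<and> (strict_antimono_on {s0 f<..} (\<lambda>C. L12 \<alpha> lam f C) \<longrightarrow>
        (\<forall>L\<in>{- (1 / \<alpha>)<..<L12 \<alpha> lam f (s0 f)}.
          \<exists>u. increasing_robin_solution \<alpha> lam f L u \<and>
            (\<forall>w. increasing_robin_solution \<alpha> lam f L w \<longrightarrow> (\<forall>x\<in>{0..L}. w x = u x))))"
proof -
  interpret robin_phase_plane f \<alpha> lam
    using assms by unfold_locales auto
  have existence: "\<exists>u. increasing_robin_solution \<alpha> lam f L u"
    if "L \<in> {- (1 / \<alpha>)<..<L12 \<alpha> lam f (s0 f)}" for L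
    using exists_energy_of_length[of L] exists_increasing_solution that by auto
  moreover have "\<exists>u. increasing_robin_solution \<alpha> lam f L u \<and>
      (\<forall>w. increasing_robin_solution \<alpha> lam f L w \<longrightarrow> (\<forall>x\<in>{0..L}. w x = u x))"
    if "strict_antimono_on {s0 f<..} (\<lambda>C. L12 \<alpha> lam f C)"
      and L: "L \<in> {- (1 / \<alpha>)<..<L12 \<alpha> lam f (s0 f)}" for L
  proof -
    have "0 < - (1 / \<alpha>)"
      using \<open>\<alpha> < 0\<close> by simp
    moreover have "- (1 / \<alpha>) < L" "L < L12 \<alpha> lam f (s0 f)"
      using L by auto
    ultimately have "0 < L" "L < L12 \<alpha> lam f (s0 f)"
      by linarith+
    then show ?thesis
      using existence[OF L] increasing_solution_unique[OF _ _ that(1)] by blast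
  qed
  ultimately show ?thesis
    using L12_greater L12_tendsto by blast
qed

end
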